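(* Let $(A,\circ,[\cdot,\cdot])$ be a Gel'fand-Dorfman algebra and $R=\mathbf{k}[\partial]A$ the Lie conformal algebra corresponding to it. Suppose that $(V,l_A,r_A,\rho_A)$ is a representation of $(A,\circ,[\cdot,\cdot])$. Then a linear map $T:V\to A$ is an $\mathcal{O}$-operator on $(A,\circ,[\cdot,\cdot])$ associated to $(V,l_A,r_A,\rho_A)$ if and only if the $\mathbf{k}[\partial]$-module homomorphism $\widetilde T:\mathbf{k}[\partial]V\to\mathbf{k}[\partial]A$ defined by $\widetilde T(v)=T(v)$ for $v\in V$ is an $\mathcal{O}$-operator on $R$ associated to $(\mathbf{k}[\partial]V,\rho_{l_A,r_A,\rho_A})$.
   Context: Conventions: $\mathbf{k}$ is a field of characteristic $0$; vector spaces over $\mathbf{k}$ are finite-dimensional; $a\star b=a\circ b+b\circ a$; $\mathbf{k}[\partial]V=\mathbf{k}[\partial]\otimes_{\mathbf{k}}V$ is the free module on $V$. A Novikov algebra $(A,\circ)$ satisfies $(a\circ b)\circ c-a\circ(b\circ c)=(b\circ a)\circ c-b\circ(a\circ c)$ and $(a\circ b)\circ c=(a\circ c)\circ b$. A Gel'fand-Dorfman (GD) algebra $(A,\circ,[\cdot,\cdot])$ is a Novikov algebra $(A,\circ)$ and a Lie algebra $(A,[\cdot,\cdot])$ with $[a\circ b,c]-[a\circ c,b]+[a,b]\circ c-[a,c]\circ b-a\circ[b,c]=0$ for all $a,b,c$. A representation $(V,l_A,r_A,\rho_A)$ of a GD algebra $A$: $l_A,r_A,\rho_A:A\to\mathrm{End}_{\mathbf{k}}(V)$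 linear, $\rho_A$ a representation of the Lie algebra $(A,[\cdot,\cdot])$, and for all $a,b\in A$, $v\in V$: $l_A(a\circ b-b\circ a)v=l_A(a)l_A(b)v-l_A(b)l_A(a)v$; $l_A(a)r_A(b)v-r_A(b)l_A(a)v=r_A(a\circ b)v-r_A(b)r_A(a)v$; $l_A(a\circ b)v=r_A(b)l_A(a)v$; $r_A(a)r_A(b)v=r_A(b)r_A(a)v$; $\rho_A(a)l_A(b)v+\rho_A(b\circ a)v+l_A([b,a])v-r_A(a)\rho_A(b)v-l_A(b)\rho_A(a)v=0$; $\rho_A(a)r_A(b)v-\rho_A(b)r_A(a)v-r_A(b)\rho_A(a)v+r_A(a)\rho_A(b)v-r_A([a,b])v=0$. $T:V\to A$ linear is an $\mathcal{O}$-operator on $(A,\circ,[\cdot,\cdot])$ associated to $(V,l_A,r_A,\rho_A)$ if $T(u)\circ T(v)=T(l_A(T(u))v+r_A(T(v))u)$ and $[T(u),T(v)]=T(\rho_A(T(u))v-\rho_A(T(v))u)$ for all $u,v\in V$. A Lie conformal algebra is a $\mathbf{k}[\partial]$-module $R$ with a $\mathbf{k}$-bilinear map $[\cdot_\lambda\cdot]:R\times R\to R[\lambda]$ such that $[\partial a_\lambda b]=-\lambda[a_\lambda b]$, $[a_\lambda\partial b]=(\lambda+\partial)[a_\lambda b]$, $[a_\lambda b]=-[b_{-\lambda-\partial}a]$, $[a_\lambda[b_\mu c]]=[[a_\lambda b]_{\lambda+\mu}c]+[b_\mu[a_\lambda c]]$. The Lie conformal algebra corresponding to a GD algebra $(A,\circ,[\cdot,\cdot])$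 is the free module $R=\mathbf{k}[\partial]A$ with $[a_\lambda b]=\partial(b\circ a)+\lambda(a\star b)+[a,b]$ for $a,b\in A$, extended by the first two identities. For a finitely generated $\mathbf{k}[\partial]$-module $M$, $\mathrm{gc}(M)$ is the space of $\mathbf{k}$-linear maps $f_\lambda:M\to M[\lambda]$ with $f_\lambda(\partial v)=(\partial+\lambda)f_\lambda(v)$, with $(\partial f)_\lambda=-\lambda f_\lambda$ and $[f_\lambda g]_\mu v=f_\lambda(g_{\mu-\lambda}v)-g_{\mu-\lambda}(f_\lambda v)$; it is a Lie conformal algebra. A representation $(M,\rho)$ of $R$ is a homomorphism of Lie conformal algebras $\rho:R\to\mathrm{gc}(M)$. The representation $(\mathbf{k}[\partial]V,\rho_{l_A,r_A,\rho_A})$ of $R=\mathbf{k}[\partial]A$ is the $\mathbf{k}[\partial]$-module homomorphism determined by $\rho_{l_A,r_A,\rho_A}(a)_\lambda v=\partial(r_A(a)v)+\lambda(l_A(a)v+r_A(a)v)+\rho_A(a)v$ for $a\in A$, $v\in V$. A $\mathbf{k}[\partial]$-module homomorphism $T:M\to R$ is an $\mathcal{O}$-operator on $R$ associated to a representation $(M,\rho)$ if $[T(u)_\lambda T(v)]=T(\rho(T(u))_\lambda v-\rho(T(v))_{-\lambda-\partial}u)$ for all $u,v\in M$. *)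

theory Defs
  imports "HOL-Computational_Algebra.Polynomial"
begin

section \<open>Gel'fand-Dorfman algebras and their representations\<close>

definition bilinear_map ::
  "('k::field \<Rightarrow> 'a::ab_group_add \<Rightarrow> 'a) \<Rightarrow> ('k \<Rightarrow> 'b::ab_group_add \<Rightarrow> 'b) \<Rightarrow>
   ('k \<Rightarrow> 'c::ab_group_add \<Rightarrow> 'c) \<Rightarrow> ('a \<Rightarrow> 'b \<Rightarrow> 'c) \<Rightarrow> bool" where
  "bilinear_map s1 s2 s3 f \<longleftrightarrow>
     (\<forall>x. Vector_Spaces.linear s2 s3 (f x)) \<and> (\<forall>y. Vector_Spaces.linear s1 s3 (\<lambda>x. f x y))"

locale fin_dim_space = vector_space scale
  for scale :: "'k::field_char_0 \<Rightarrow> 'a::ab_group_add \<Rightarrow> 'a" +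
  assumes fin_dim: "\<exists>B. finite B \<and> span B = UNIV"

locale novikov_algebra = fin_dim_space sA
  for sA :: "'k::field_char_0 \<Rightarrow> 'a::ab_group_add \<Rightarrow> 'a" +
  fixes circ :: "'a \<Rightarrow> 'a \<Rightarrow> 'a"  (infixl "\<odot>" 70)
  assumes circ_bilinear: "bilinear_map sA sA sA circ"
    and left_symmetric: "(a \<odot> b) \<odot> c - a \<odot> (b \<odot> c) = (b \<odot> a) \<odot> c - b \<odot> (a \<odot> c)"
    and right_commutative: "(a \<odot> b) \<odot> c = (a \<odot> c) \<odot> b"

locale lie_algebra = fin_dim_space sA
  for sA :: "'k::field_char_0 \<Rightarrow> 'a::ab_group_add \<Rightarrow> 'a" +
  fixes lie :: "'a \<Rightarrow> 'a \<Rightarrow> 'a"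
  assumes lie_bilinear: "bilinear_map sA sA sA lie"
    and lie_alternating: "lie a a = 0"
    and lie_jacobi: "lie a (lie b c) + lie b (lie c a) + lie c (lie a b) = 0"

locale gd_algebra = novikov_algebra sA circ + lie_algebra sA lie
  for sA :: "'k::field_char_0 \<Rightarrow> 'a::ab_group_add \<Rightarrow> 'a"
    and circ :: "'a \<Rightarrow> 'a \<Rightarrow> 'a"  (infixl "\<odot>" 70)
    and lie :: "'a \<Rightarrow> 'a \<Rightarrow> 'a" +
  assumes gd_compatible:
    "lie (a \<odot> b) c - lie (a \<odot> c) b + lie a b \<odot> c - lie a c \<odot> b - a \<odot> lie b c = 0"

text \<open>The actions \<open>l\<close>, \<open>r\<close>, \<open>\<rho>\<close> are curried: \<open>l a v\<close> stands for $l_A(a)v$.\<close>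

locale gd_representation = gd_algebra sA circ lie + V: fin_dim_space sV
  for sA :: "'k::field_char_0 \<Rightarrow> 'a::ab_group_add \<Rightarrow> 'a"
    and circ :: "'a \<Rightarrow> 'a \<Rightarrow> 'a"  (infixl "\<odot>" 70)
    and lie :: "'a \<Rightarrow> 'a \<Rightarrow> 'a"
    and sV :: "'k \<Rightarrow> 'v::ab_group_add \<Rightarrow> 'v" +
  fixes l r \<rho> :: "'a \<Rightarrow> 'v \<Rightarrow> 'v"
  assumes l_bilinear: "bilinear_map sA sV sV l"
    and r_bilinear: "bilinear_map sA sV sV r"
    and rho_bilinear: "bilinear_map sA sV sV \<rho>"
    and rho_lie: "\<rho> (lie a b) v = \<rho> a (\<rho> b v) - \<rho> b (\<rho> a v)"
    and rep_l_commutator: "l (a \<odot> b - b \<odot> a) v = l a (l b v) - l b (l a v)"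
    and rep_l_r: "l a (r b v) - r b (l a v) = r (a \<odot> b) v - r b (r a v)"
    and rep_l_circ: "l (a \<odot> b) v = r b (l a v)"
    and rep_r_r: "r a (r b v) = r b (r a v)"
    and rep_gd_1:
      "\<rho> a (l b v) + \<rho> (b \<odot> a) v + l (lie b a) v - r a (\<rho> b v) - l b (\<rho> a v) = 0"
    and rep_gd_2:
      "\<rho> a (r b v) - \<rho> b (r a v) - r b (\<rho> a v) + r a (\<rho> b v) - r (lie a b) v = 0"

locale gd_O_operator = gd_representation sA circ lie sV l r \<rho>
  for sA :: "'k::field_char_0 \<Rightarrow> 'a::ab_group_add \<Rightarrow> 'a"
    and circ :: "'a \<Rightarrow> 'a \<Rightarrow> 'a"  (infixl "\<odot>" 70)
    and lie :: "'a \<Rightarrow> 'a \<Rightarrow> 'a"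
    and sV :: "'k \<Rightarrow> 'v::ab_group_add \<Rightarrow> 'v"
    and l r \<rho> :: "'a \<Rightarrow> 'v \<Rightarrow> 'v" +
  fixes T :: "'v \<Rightarrow> 'a"
  assumes T_linear: "Vector_Spaces.linear sV sA T"
    and T_circ: "T u \<odot> T v = T (l (T u) v + r (T v) u)"
    and T_lie: "lie (T u) (T v) = T (\<rho> (T u) v - \<rho> (T v) u)"


section \<open>Polynomials with coefficients in a module\<close>

text \<open>
  For an additive group \<open>M\<close>, the space $M[\lambda]$ is the type \<open>'m poly\<close>, and
  $M[\lambda,\mu] = M[\lambda][\mu]$ is \<open>'m poly poly\<close> (outer variable $\mu$). Multiplication by the
  variable of \<open>'m poly\<close> is \<open>pCons 0\<close>, and \<open>map_poly\<close> applies an additive map to the coefficients.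

  \<open>subst_op D e p\<close> substitutes for the variable of \<open>p\<close> the additive operator \<open>D\<close>, after the
  coefficients have been sent to the target by \<open>e\<close>: it maps $\sum_i x^i p_i$ to $\sum_i D^i (e(p_i))$.
\<close>

definition subst_op :: "('n \<Rightarrow> 'n) \<Rightarrow> ('m::zero \<Rightarrow> 'n::comm_monoid_add) \<Rightarrow> 'm poly \<Rightarrow> 'n" where
  "subst_op D e p = (\<Sum>i\<le>degree p. (D ^^ i) (e (coeff p i)))"

definition lam :: "'m::zero poly poly \<Rightarrow> 'm poly poly" where
  "lam = map_poly (pCons 0)"

definition mu :: "'m::zero poly poly \<Rightarrow> 'm poly poly" where
  "mu = pCons 0"

definition const2 :: "'m::zero \<Rightarrow> 'm poly poly" where
  "const2 m = [:[:m:]:]"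


section \<open>Lie conformal algebras\<close>

text \<open>
  A $\mathbf{k}[\partial]$-module is a module over the ring \<open>'k poly\<close>; \<open>const_act s c\<close> and \<open>der s\<close>
  are the actions of a scalar \<open>c\<close> and of $\partial$.
\<close>

definition const_act :: "('k::comm_ring_1 poly \<Rightarrow> 'm::ab_group_add \<Rightarrow> 'm) \<Rightarrow> 'k \<Rightarrow> 'm \<Rightarrow> 'm" where
  "const_act s c = s [:c:]"

definition der :: "('k::comm_ring_1 poly \<Rightarrow> 'm::ab_group_add \<Rightarrow> 'm) \<Rightarrow> 'm \<Rightarrow> 'm" where
  "der s = s [:0, 1:]"

text \<open>Multiplication by $\lambda + \partial$ on $M[\lambda]$.\<close>

definition lam_plus_der ::
  "('k::comm_ring_1 poly \<Rightarrow> 'm::ab_group_add \<Rightarrow> 'm) \<Rightarrow> 'm poly \<Rightarrow> 'm poly" where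
  "lam_plus_der s p = pCons 0 p + map_poly (der s) p"

text \<open>For \<open>p\<close> in $M[x]$, the element of $M[\lambda]$ obtained by $x := -\lambda - \partial$.\<close>

definition at_neg_lam_der ::
  "('k::comm_ring_1 poly \<Rightarrow> 'm::ab_group_add \<Rightarrow> 'm) \<Rightarrow> 'm poly \<Rightarrow> 'm poly" where
  "at_neg_lam_der s p = subst_op (\<lambda>q. - lam_plus_der s q) (\<lambda>m. [:m:]) p"

text \<open>
  In the Jacobi identity an iterated bracket is expanded along the coefficients of the inner
  bracket; e.g. if $[b_\mu c] = \sum_i \mu^i d_i$ then
  $[a_\lambda[b_\mu c]] = \sum_i \mu^i [a_\lambda d_i]$.
\<close>

locale lie_conformal_algebra = module sR
  for sR :: "'k::field_char_0 poly \<Rightarrow> 'r::ab_group_add \<Rightarrow> 'r" +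
  fixes br :: "'r \<Rightarrow> 'r \<Rightarrow> 'r poly"
  assumes br_add_left: "br (a + b) c = br a c + br b c"
    and br_add_right: "br a (b + c) = br a b + br a c"
    and br_scale_left: "br (const_act sR k a) b = map_poly (const_act sR k) (br a b)"
    and br_scale_right: "br a (const_act sR k b) = map_poly (const_act sR k) (br a b)"
    and br_der_left: "br (der sR a) b = - pCons 0 (br a b)"
    and br_der_right: "br a (der sR b) = lam_plus_der sR (br a b)"
    and br_skew: "br a b = - at_neg_lam_der sR (br b a)"
    and br_jacobi:
      "subst_op mu (\<lambda>d. subst_op lam const2 (br a d)) (br b c) =
       subst_op lam (\<lambda>d. subst_op (\<lambda>p. lam p + mu p) const2 (br d c)) (br a b) +
       subst_op lam (\<lambda>d. subst_op mu const2 (br b d)) (br a c)"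

text \<open>An element $f$ of $\mathrm{gc}(M)$ is given by \<open>f v\<close> $= f_\lambda(v) \in M[\lambda]$.\<close>

definition gc ::
  "('k::field_char_0 poly \<Rightarrow> 'm::ab_group_add \<Rightarrow> 'm) \<Rightarrow> ('m \<Rightarrow> 'm poly) set" where
  "gc sM = {f. (\<forall>u v. f (u + v) = f u + f v) \<and>
               (\<forall>k v. f (const_act sM k v) = map_poly (const_act sM k) (f v)) \<and>
               (\<forall>v. f (der sM v) = lam_plus_der sM (f v))}"

text \<open>
  \<open>gc_bracket f g v\<close> is $[f_\lambda g]_\mu v = f_\lambda(g_{\mu-\lambda} v) - g_{\mu-\lambda}(f_\lambda v)$
  in $M[\lambda,\mu]$.
\<close>

definition gc_bracket ::
  "('m::ab_group_add \<Rightarrow> 'm poly) \<Rightarrow> ('m \<Rightarrow> 'm poly) \<Rightarrow> 'm \<Rightarrow> 'm poly poly" where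
  "gc_bracket f g v =
     subst_op (\<lambda>p. mu p - lam p) (\<lambda>d. subst_op lam const2 (f d)) (g v) -
     subst_op lam (\<lambda>d. subst_op (\<lambda>p. mu p - lam p) const2 (g d)) (f v)"

text \<open>
  \<open>\<rho> a v\<close> stands for $\rho(a)_\lambda v$. The assumptions from \<open>rho_add\<close> on say that \<open>\<rho>\<close> is a
  homomorphism of Lie conformal algebras to $\mathrm{gc}(M)$, whose module structure is given by the
  $\mathbf{k}$-linear structure on values and $(\partial f)_\lambda = -\lambda f_\lambda$; equality in
  $\mathrm{gc}(M)[\lambda]$ is tested by applying both sides, with index $\mu$, to every \<open>v\<close>.
\<close>

locale conformal_representation = lie_conformal_algebra sR br + M: module sM
  for sR :: "'k::field_char_0 poly \<Rightarrow> 'r::ab_group_add \<Rightarrow> 'r"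
    and br :: "'r \<Rightarrow> 'r \<Rightarrow> 'r poly"
    and sM :: "'k poly \<Rightarrow> 'm::ab_group_add \<Rightarrow> 'm" +
  fixes \<rho> :: "'r \<Rightarrow> 'm \<Rightarrow> 'm poly"
  assumes finitely_generated: "\<exists>S. finite S \<and> M.span S = UNIV"
    and rho_gc: "\<rho> a \<in> gc sM"
    and rho_add: "\<rho> (a + b) v = \<rho> a v + \<rho> b v"
    and rho_scale: "\<rho> (const_act sR k a) v = map_poly (const_act sM k) (\<rho> a v)"
    and rho_der: "\<rho> (der sR a) v = - pCons 0 (\<rho> a v)"
    and rho_bracket:
      "subst_op lam (\<lambda>d. subst_op mu const2 (\<rho> d v)) (br a b) = gc_bracket (\<rho> a) (\<rho> b) v"

locale conformal_O_operator = conformal_representation sR br sM \<rho>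
  for sR :: "'k::field_char_0 poly \<Rightarrow> 'r::ab_group_add \<Rightarrow> 'r"
    and br :: "'r \<Rightarrow> 'r \<Rightarrow> 'r poly"
    and sM :: "'k poly \<Rightarrow> 'm::ab_group_add \<Rightarrow> 'm"
    and \<rho> :: "'r \<Rightarrow> 'm \<Rightarrow> 'm poly" +
  fixes T :: "'m \<Rightarrow> 'r"
  assumes T_hom: "module_hom sM sR T"
    and T_br: "br (T u) (T v) = map_poly T (\<rho> (T u) v - at_neg_lam_der sM (\<rho> (T v) u))"


section \<open>The free module, and the structures coming from a Gel'fand-Dorfman algebra\<close>

text \<open>
  $\mathbf{k}[\partial]V$ is the type \<open>'v poly\<close>, with $\partial^i \otimes v$ corresponding to
  \<open>monom v i\<close>; so here the variable of \<open>'v poly\<close> is $\partial$, and an element of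
  $(\mathbf{k}[\partial]V)[\lambda]$ is a polynomial in the outer variable $\lambda$ over polynomials
  in $\partial$. \<open>free_scale s\<close> is the action of $\mathbf{k}[\partial]$.
\<close>

definition free_scale ::
  "('k::field_char_0 \<Rightarrow> 'v::ab_group_add \<Rightarrow> 'v) \<Rightarrow> 'k poly \<Rightarrow> 'v poly \<Rightarrow> 'v poly" where
  "free_scale s q x = subst_op (pCons 0) (\<lambda>c. map_poly (s c) x) q"

text \<open>
  The extension of the formulas on \<open>A\<close> (or on \<open>A\<close> and \<open>V\<close>) by sesquilinearity: $\partial$ in the
  first argument becomes $-\lambda$, and $\partial$ in the second argument becomes
  $\lambda + \partial$.
\<close>

definition sesqui_ext ::
  "('k::field_char_0 \<Rightarrow> 'w::ab_group_add \<Rightarrow> 'w) \<Rightarrow>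
   ('a::ab_group_add \<Rightarrow> 'v::ab_group_add \<Rightarrow> 'w poly poly) \<Rightarrow> 'a poly \<Rightarrow> 'v poly \<Rightarrow> 'w poly poly" where
  "sesqui_ext s f x y =
     subst_op (\<lambda>p. - pCons 0 p) (\<lambda>a. subst_op (lam_plus_der (free_scale s)) (f a) y) x"

text \<open>The coefficients at $\lambda^0$ and $\lambda^1$ are $[a,b] + \partial(b \circ a)$ and $a \star b$.\<close>

definition gd_bracket ::
  "('k::field_char_0 \<Rightarrow> 'a::ab_group_add \<Rightarrow> 'a) \<Rightarrow> ('a \<Rightarrow> 'a \<Rightarrow> 'a) \<Rightarrow> ('a \<Rightarrow> 'a \<Rightarrow> 'a) \<Rightarrow>
   'a poly \<Rightarrow> 'a poly \<Rightarrow> 'a poly poly" where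
  "gd_bracket sA circ lie =
     sesqui_ext sA (\<lambda>a b. [: [:lie a b, circ b a:], [:circ a b + circ b a:] :])"

definition gd_rho ::
  "('k::field_char_0 \<Rightarrow> 'v::ab_group_add \<Rightarrow> 'v) \<Rightarrow>
   ('a::ab_group_add \<Rightarrow> 'v \<Rightarrow> 'v) \<Rightarrow> ('a \<Rightarrow> 'v \<Rightarrow> 'v) \<Rightarrow> ('a \<Rightarrow> 'v \<Rightarrow> 'v) \<Rightarrow>
   'a poly \<Rightarrow> 'v poly \<Rightarrow> 'v poly poly" where
  "gd_rho sV l r \<rho> =
     sesqui_ext sV (\<lambda>a v. [: [:\<rho> a v, r a v:], [:l a v + r a v:] :])"

text \<open>The $\mathbf{k}[\partial]$-linear extension $\widetilde T$ of $T$.\<close>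

definition free_ext :: "('v::ab_group_add \<Rightarrow> 'a::ab_group_add) \<Rightarrow> 'v poly \<Rightarrow> 'a poly" where
  "free_ext T = map_poly T"

end

theory Submission
  imports Defs
begin

text \<open>
  Everything is controlled by the generators. A bracket on $\mathbf{k}[\partial]A$ or an action on
  $\mathbf{k}[\partial]V$ is sesquilinear: $\partial$ in the first slot comes out as $-\lambda$,
  in the second slot as $\lambda + \partial$. Two biadditive maps that follow the same rules for
  $\partial$ in each slot agree as soon as they agree on constant polynomials
  (\<open>sesquilinear_unique\<close>).

  Both sides of the equation defining an $\mathcal{O}$-operator on $\mathbf{k}[\partial]A$ follow
  the same rules in $u$ and $v$. For the term $\rho(T(v))_{-\lambda-\partial}u$, in which
  the slots are exchanged, this is because $x \mapsto -\lambda-\partial$ sends $-x$ to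
  $\lambda + \partial$, and $x + \partial$ to $-\lambda$. So the equation may be tested for $u$, $v$
  in $V$, where both sides are polynomials of degree at most one in $\partial$ and
  $\lambda$. Comparing coefficients (\<open>conformal_O_operator_on_constants\<close>) gives the Lie condition
  at the constant term, the condition for $T(v) \circ T(u)$ at $\partial$, and at $\lambda$ the
  sum of the conditions for $T(u) \circ T(v)$ and $T(v) \circ T(u)$, which follows from them. This is
  the equivalence.

  The conformal notion of $\mathcal{O}$-operator also contains the statements that
  $\mathbf{k}[\partial]A$ is a Lie conformal algebra and that $\mathbf{k}[\partial]V$ is a
  representation of it. Their core is one identity,
  \[ a_X (b_Y c) = [a_X b]_{X+Y}\, c + b_Y (a_X c), \]
  where $X$ and $Y$ are any commuting additive operators on the target $M[\lambda,\mu]$ that also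
  commute with $\partial$ (\<open>jacobi\<close>). With $X = \lambda$, $Y = \mu$ and the adjoint
  representation it is the Jacobi identity of $\mathbf{k}[\partial]A$; with
  $X = \lambda$, $Y = \mu - \lambda$ it says that $\rho$ respects brackets. All three terms obey the
  same rules for $\partial$ in $a$, $b$ and $c$, so again only generators matter; there the
  difference of the two sides is a polynomial of degree two in $\partial$, $X$, $Y$,
  and its ten coefficients are consequences of the axioms of a representation
  (\<open>jacobi_const\<close>).
\<close>


section \<open>Substituting operators into polynomials over a module\<close>

lemma additive_compose: "additive f \<Longrightarrow> additive g \<Longrightarrow> additive (\<lambda>x. f (g x))"
  by (simp add: additive_def)

lemma additive_plus: "additive f \<Longrightarrow> additive g \<Longrightarrow> additive (\<lambda>x. f x + g x)"
  by (simp add: additive_def)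

lemma additive_uminus: "additive f \<Longrightarrow> additive (\<lambda>x. - f x)"
  by (simp add: additive_def)

lemma additive_pCons_0: "additive (pCons 0)"
  by (simp add: additive_def)

lemma additive_const_poly: "additive (\<lambda>a. [:a:])"
  by (simp add: additive_def)

lemma map_poly_add:
  assumes "additive f"
  shows "map_poly f (p + q) = map_poly f p + map_poly f q"
  by (rule poly_eqI) (simp add: coeff_map_poly additive.zero[OF assms] additive.add[OF assms])

lemma additive_map_poly: "additive f \<Longrightarrow> additive (map_poly f)"
  by (simp add: additive_def[of "map_poly f"] map_poly_add)

lemma map_poly_pCons_additive:
  "additive f \<Longrightarrow> map_poly f (pCons a p) = pCons (f a) (map_poly f p)"
  by (simp add: map_poly_pCons additive.zero)

lemma map_poly_map_poly_additive:
  "additive f \<Longrightarrow> additive g \<Longrightarrow> map_poly f (map_poly g p) = map_poly (\<lambda>x. f (g x)) p"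
  by (rule poly_eqI) (simp add: coeff_map_poly additive.zero)

text \<open>
  The one-variable principle behind all reductions to generators: an additive map on
  $\mathbf{k}[\partial]V$ that turns $\partial$ into a given operator is determined by its values on
  $V$.
\<close>
lemma poly_additive_ext:
  fixes f g :: "'a::ab_group_add poly \<Rightarrow> 'b::ab_group_add"
  assumes "additive f" "additive g"
    and "\<And>a. f [:a:] = g [:a:]"
    and "\<And>p. f (pCons 0 p) = D (f p)" "\<And>p. g (pCons 0 p) = D (g p)"
  shows "f p = g p"
proof (induction p)
  case 0
  show ?case by (simp add: additive.zero assms)
next
  case (pCons a p)
  have "pCons a p = [:a:] + pCons 0 p" by simp
  then show ?case
    using pCons.IH by (metis additive.add assms)
qed

lemma subst_op_0: "additive e \<Longrightarrow> subst_op D e 0 = 0"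
  by (simp add: subst_op_def additive.zero)

lemma subst_op_const: "subst_op D e [:a:] = e a"
  by (simp add: subst_op_def)

text \<open>Horner's scheme; every later computation with substitutions goes through it.\<close>
lemma subst_op_pCons:
  assumes "additive D" "additive e"
  shows "subst_op D e (pCons a p) = e a + D (subst_op D e p)"
proof (cases "p = 0")
  case True
  then show ?thesis by (simp add: subst_op_const subst_op_0 assms additive.zero)
next
  case False
  then show ?thesis
    by (simp add: subst_op_def sum.atMost_Suc_shift additive.sum[OF assms(1)]
        del: sum.atMost_Suc)
qed

lemma subst_op_pCons_0:
  "additive D \<Longrightarrow> additive e \<Longrightarrow> subst_op D e (pCons 0 p) = D (subst_op D e p)"
  by (simp add: subst_op_pCons additive.zero)

lemma additive_subst_op:
  assumes "additive D" "additive e"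
  shows "additive (subst_op D e)"
proof
  fix p q
  show "subst_op D e (p + q) = subst_op D e p + subst_op D e q"
    by (induction p q rule: poly_induct2)
      (simp_all add: subst_op_pCons subst_op_0 assms additive.add[OF assms(1)]
        additive.add[OF assms(2)] add_ac)
qed

lemma subst_op_map_poly:
  assumes "additive D" "additive e" "additive g"
  shows "subst_op D e (map_poly g p) = subst_op D (\<lambda>x. e (g x)) p"
  by (induction p)
    (simp_all add: map_poly_pCons_additive subst_op_pCons subst_op_0 assms additive_compose)

lemma subst_op_apply:
  assumes "additive D" "additive e" "additive D'" "additive h" "\<And>x. h (D x) = D' (h x)"
  shows "h (subst_op D e p) = subst_op D' (\<lambda>x. h (e x)) p"
  by (induction p)
    (simp_all add: subst_op_pCons subst_op_0 assms additive_compose additive.zero[OF assms(4)]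
       additive.add[OF assms(4)])

lemma subst_op_plus_fun:
  assumes "additive D" "additive e" "additive e'"
  shows "subst_op D (\<lambda>x. e x + e' x) p = subst_op D e p + subst_op D e' p"
  by (induction p)
    (simp_all add: subst_op_pCons subst_op_0 assms additive_plus additive.zero[OF assms(1)]
       additive.add[OF assms(1)] algebra_simps)

lemma subst_op_uminus_fun:
  assumes "additive D" "additive e"
  shows "subst_op D (\<lambda>x. - e x) p = - subst_op D e p"
  by (induction p)
    (simp_all add: subst_op_pCons subst_op_0 assms additive_uminus additive.zero[OF assms(1)]
       additive.minus[OF assms(1)] additive.diff[OF assms(1)] algebra_simps)

lemma additive_subst_op_fun:
  assumes "additive D" "\<And>d. additive (\<lambda>x. e x d)" "\<And>x. additive (e x)"
  shows "additive (\<lambda>x. subst_op D (e x) p)"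
proof
  fix x y
  have "e (x + y) = (\<lambda>d. e x d + e y d)"
    using assms(2) by (auto simp: additive_def)
  then show "subst_op D (e (x + y)) p = subst_op D (e x) p + subst_op D (e y) p"
    by (simp add: subst_op_plus_fun assms)
qed

lemma additive_lam: "additive lam"
  unfolding lam_def by (intro additive_map_poly additive_pCons_0)

lemma additive_mu: "additive mu"
  unfolding mu_def by (rule additive_pCons_0)

lemma additive_const2: "additive const2"
  by (simp add: additive_def const2_def)


section \<open>The free module\<close>

lemma bilinear_map_additive:
  assumes "bilinear_map s1 s2 s3 f"
  shows "additive (f x)" "additive (\<lambda>x. f x y)"
  using assms
  by (auto simp: bilinear_map_def module_hom_iff_linear[symmetric] module_hom_iff additive_def)

lemma bilinear_map_scale:
  assumes "bilinear_map s1 s2 s3 f"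
  shows "f x (s2 k y) = s3 k (f x y)" "f (s1 k x) y = s3 k (f x y)"
  using assms
  by (auto simp: bilinear_map_def module_hom_iff_linear[symmetric] module_hom_iff)

lemma additive_scale: "vector_space s \<Longrightarrow> additive (s c)"
  by (simp add: additive_def vector_space.vector_space_assms)

lemma additive_scale_left:
  assumes "vector_space s"
  shows "additive (\<lambda>c. map_poly (s c) x)"
proof -
  interpret vector_space s by fact
  show ?thesis
    by (intro additive.intro poly_eqI)
       (simp add: coeff_map_poly scale_left_distrib)
qed

lemma const_act_free_scale: "const_act (free_scale s) c = map_poly (s c)"
  by (simp add: const_act_def free_scale_def subst_op_const fun_eq_iff)

lemma free_scale_pCons:
  assumes "vector_space s"
  shows "free_scale s (pCons c q) x = map_poly (s c) x + pCons 0 (free_scale s q x)"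
  by (simp add: free_scale_def subst_op_pCons additive_pCons_0 additive_scale_left assms)

lemma free_scale_0: "vector_space s \<Longrightarrow> free_scale s 0 x = 0"
  by (simp add: free_scale_def subst_op_0 additive_scale_left)

lemma der_free_scale:
  assumes "vector_space s"
  shows "der (free_scale s) = pCons 0"
proof -
  interpret vector_space s by fact
  show ?thesis
    by (auto simp: fun_eq_iff der_def free_scale_pCons free_scale_0 assms poly_eq_iff
      coeff_map_poly coeff_pCons split: nat.splits)
qed

lemma module_free_scale:
  assumes "vector_space s"
  shows "module (free_scale s)"
proof -
  interpret s: vector_space s by fact
  note addS = additive_scale[OF assms]
  have right: "free_scale s p (x + y) = free_scale s p x + free_scale s p y" for p x y
    by (induction p)
      (simp_all add: free_scale_pCons free_scale_0 assms map_poly_add addS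
         additive.add[OF additive_pCons_0] add_ac del: add_pCons)
  have left: "free_scale s (p + q) x = free_scale s p x + free_scale s q x" for p q x
    unfolding free_scale_def
    by (intro additive.add additive_subst_op additive_pCons_0 additive_scale_left assms)
  have smult: "free_scale s (smult c q) x = map_poly (s c) (free_scale s q x)" for c q x
    by (induction q)
      (simp_all add: free_scale_pCons free_scale_0 assms map_poly_add addS
         map_poly_map_poly_additive map_poly_pCons_additive)
  have scale: "free_scale s p (free_scale s q x) = free_scale s (p * q) x" for p q x
    by (induction p)
      (simp_all add: free_scale_pCons free_scale_0 assms left smult
         additive.zero[OF additive_scale_left])
  have one: "free_scale s 1 x = x" for x
    by (simp add: one_pCons free_scale_pCons free_scale_0 assms map_poly_idI)
  show ?thesis
    by unfold_locales (simp_all add: right left scale one)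
qed

text \<open>
  A basis of \<open>V\<close> generates, since scalars reach all constants and $\partial$ raises the degree.
\<close>
lemma free_module_finitely_generated:
  assumes "fin_dim_space s"
  shows "\<exists>S. finite S \<and> module.span (free_scale s) S = UNIV"
proof -
  interpret s: fin_dim_space s by fact
  interpret M: module "free_scale s"
    by (rule module_free_scale) unfold_locales
  obtain B where B: "finite B" "s.span B = UNIV" using s.fin_dim by blast
  let ?S = "(\<lambda>b. [:b:]) ` B"
  have const: "[:a:] \<in> M.span ?S" for a
  proof -
    have "a \<in> s.span B" using B by simp
    then show ?thesis
    proof (induction rule: s.span_induct_alt)
      case base
      show ?case by (simp add: M.span_zero)
    next
      case (step c x y)
      have eq: "[:s c x + y:] = free_scale s [:c:] [:x:] + [:y:]"
        using fun_cong[OF const_act_free_scale[of s c], of "[:x:]"]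
        by (simp add: const_act_def map_poly_pCons)
      show ?case
        unfolding eq using step by (blast intro: M.span_add M.span_scale M.span_base)
    qed
  qed
  have "p \<in> M.span ?S" for p
  proof (induction p)
    case 0
    show ?case by (rule M.span_zero)
  next
    case (pCons a p)
    have "pCons a p = [:a:] + free_scale s [:0, 1:] p"
      using der_free_scale[of s] s.vector_space_axioms
      by (simp add: der_def fun_eq_iff)
    then show ?case
      using const pCons.IH M.span_add M.span_scale by metis
  qed
  then show ?thesis using B(1) by blast
qed


section \<open>Sesquilinear extension\<close>

lemma lam_plus_der_free:
  "vector_space s \<Longrightarrow> lam_plus_der (free_scale s) p = pCons 0 p + map_poly (pCons 0) p"
  by (simp add: lam_plus_der_def der_free_scale)

lemma additive_lam_plus_der:
  "vector_space s \<Longrightarrow> additive (lam_plus_der (free_scale s))"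
  by (simp add: additive_def lam_plus_der_free map_poly_add additive_pCons_0
      additive.add[OF additive_pCons_0] add_ac del: add_pCons)

lemma sesquilinear_unique:
  fixes F G :: "'a::ab_group_add poly \<Rightarrow> 'v::ab_group_add poly \<Rightarrow> 'n::ab_group_add"
  assumes "\<And>x. additive (F x)" "\<And>x. additive (G x)"
    and "\<And>y. additive (\<lambda>x. F x y)" "\<And>y. additive (\<lambda>x. G x y)"
    and "\<And>x y. F (pCons 0 x) y = P (F x y)" "\<And>x y. G (pCons 0 x) y = P (G x y)"
    and "\<And>x y. F x (pCons 0 y) = Q (F x y)" "\<And>x y. G x (pCons 0 y) = Q (G x y)"
    and const: "\<And>a v. F [:a:] [:v:] = G [:a:] [:v:]"
  shows "F x y = G x y"
proof -
  have eq: "F [:a:] y = G [:a:] y" for a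
    by (rule poly_additive_ext[where D = Q and f = "F [:a:]" and g = "G [:a:]"])
      (simp_all add: assms)
  show ?thesis
    by (rule poly_additive_ext[where D = P and f = "\<lambda>x. F x y" and g = "\<lambda>x. G x y"])
      (simp_all add: assms eq)
qed

text \<open>
  What the extension of a biadditive \<open>f\<close> provides: the rules for $\partial$ in each slot
  and the values \<open>f\<close> on constants, which together characterise it.
\<close>
locale sesquilinear_extension = vector_space s
  for s :: "'k::field_char_0 \<Rightarrow> 'w::ab_group_add \<Rightarrow> 'w" +
  fixes f :: "'a::ab_group_add \<Rightarrow> 'v::ab_group_add \<Rightarrow> 'w poly poly"
  assumes additive_f_right: "additive (f a)"
    and additive_f_left: "additive (\<lambda>a. f a v)"
begin

abbreviation "L \<equiv> lam_plus_der (free_scale s)"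

lemma vector_space_s: "vector_space s"
  by unfold_locales

lemma additive_L: "additive L"
  by (rule additive_lam_plus_der) (rule vector_space_s)

lemma L_eq: "L p = pCons 0 p + map_poly (pCons 0) p"
  by (rule lam_plus_der_free) (rule vector_space_s)

lemma additive_neg_pCons: "additive (\<lambda>p::'w poly poly. - pCons 0 p)"
  by (intro additive_uminus additive_pCons_0)

lemma additive_inner_left: "additive (\<lambda>a. subst_op L (f a) y)"
  by (intro additive_subst_op_fun additive_L additive_f_left additive_f_right)

lemma additive_inner_right: "additive (\<lambda>y. subst_op L (f a) y)"
  by (intro additive_subst_op additive_L additive_f_right)

lemma sesqui_ext_additive_left: "additive (\<lambda>x. sesqui_ext s f x y)"
  unfolding sesqui_ext_def
  by (intro additive_subst_op additive_neg_pCons additive_inner_left)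

lemma sesqui_ext_additive_right: "additive (sesqui_ext s f x)"
  unfolding sesqui_ext_def
  by (intro additive_subst_op_fun additive_neg_pCons additive_inner_left additive_inner_right)

lemmas sesqui_ext_add_left = additive.add[OF sesqui_ext_additive_left]
  and sesqui_ext_add_right = additive.add[OF sesqui_ext_additive_right]

lemma sesqui_ext_der_left: "sesqui_ext s f (pCons 0 x) y = - pCons 0 (sesqui_ext s f x y)"
  unfolding sesqui_ext_def
  by (rule subst_op_pCons_0) (intro additive_neg_pCons additive_inner_left)+

text \<open>
  The second slot is the inner one, so its $\lambda + \partial$ has to be moved through the outer
  substitution of $-\lambda$; the two operators commute.
\<close>
lemma sesqui_ext_der_right: "sesqui_ext s f x (pCons 0 y) = L (sesqui_ext s f x y)"
proof -
  have "L (- pCons 0 p) = - pCons 0 (L p)" for p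
    by (simp add: L_eq map_poly_pCons_additive additive_pCons_0
       additive.minus[OF additive_map_poly[OF additive_pCons_0]]
       additive.add[OF additive_pCons_0] additive.minus[OF additive_pCons_0]
       del: add_pCons minus_pCons diff_pCons)
  then have "L (sesqui_ext s f x y) =
      subst_op (\<lambda>p. - pCons 0 p) (\<lambda>a. L (subst_op L (f a) y)) x"
    unfolding sesqui_ext_def
    by (intro subst_op_apply additive_neg_pCons additive_L additive_inner_left)
  then show ?thesis
    by (simp add: sesqui_ext_def subst_op_pCons_0 additive_L additive_f_right)
qed

lemma sesqui_ext_const: "sesqui_ext s f [:a:] [:v:] = f a v"
  by (simp add: sesqui_ext_def subst_op_const)

lemma coefficientwise_scale_L:
  "map_poly (map_poly (s k)) (L p) = L (map_poly (map_poly (s k)) p)"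
proof -
  note adds = additive_scale[OF vector_space_s, of k]
  show ?thesis
    by (simp add: L_eq map_poly_pCons_additive map_poly_add map_poly_map_poly_additive
        additive_map_poly adds additive_pCons_0)
qed

lemma coefficientwise_scale_pCons:
  "map_poly (map_poly (s k)) (- pCons 0 p) = - pCons 0 (map_poly (map_poly (s k)) p)"
proof -
  note adds = additive_scale[OF vector_space_s, of k]
  show ?thesis
    by (simp add: additive.minus[OF additive_map_poly[OF additive_map_poly[OF adds]]]
        map_poly_pCons_additive additive_map_poly adds del: minus_pCons)
qed

lemma sesqui_ext_scale_left:
  assumes "vector_space t" "\<And>a v. f (t k a) v = map_poly (map_poly (s k)) (f a v)"
  shows "sesqui_ext s f (map_poly (t k) x) y = map_poly (map_poly (s k)) (sesqui_ext s f x y)"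
proof -
  note adds = additive_scale[OF vector_space_s, of k] and addt = additive_scale[OF assms(1), of k]
  have add_s: "map_poly (map_poly (s k)) (p + q) =
      map_poly (map_poly (s k)) p + map_poly (map_poly (s k)) q" for p q
    by (rule map_poly_add) (intro additive_map_poly adds)
  have add_t: "map_poly (t k) (p + q) = map_poly (t k) p + map_poly (t k) q" for p q
    by (rule map_poly_add) (rule addt)
  have pCons_t: "map_poly (t k) (pCons a p) = pCons (t k a) (map_poly (t k) p)" for a p
    by (rule map_poly_pCons_additive) (rule addt)
  show ?thesis
    by (rule sesquilinear_unique[where P = "\<lambda>p. - pCons 0 p" and Q = L
          and F = "\<lambda>x y. sesqui_ext s f (map_poly (t k) x) y"
          and G = "\<lambda>x y. map_poly (map_poly (s k)) (sesqui_ext s f x y)"];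
        (rule additive.intro)?; simp add: add_s add_t pCons_t additive.zero[OF addt]
        sesqui_ext_add_left sesqui_ext_add_right sesqui_ext_der_left
        sesqui_ext_der_right coefficientwise_scale_L coefficientwise_scale_pCons
        sesqui_ext_const assms del: minus_pCons)
qed

lemma sesqui_ext_scale_right:
  assumes "vector_space t" "\<And>a v. f a (t k v) = map_poly (map_poly (s k)) (f a v)"
  shows "sesqui_ext s f x (map_poly (t k) y) = map_poly (map_poly (s k)) (sesqui_ext s f x y)"
proof -
  note adds = additive_scale[OF vector_space_s, of k] and addt = additive_scale[OF assms(1), of k]
  have add_s: "map_poly (map_poly (s k)) (p + q) =
      map_poly (map_poly (s k)) p + map_poly (map_poly (s k)) q" for p q
    by (rule map_poly_add) (intro additive_map_poly adds)
  have add_t: "map_poly (t k) (p + q) = map_poly (t k) p + map_poly (t k) q" for p q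
    by (rule map_poly_add) (rule addt)
  have pCons_t: "map_poly (t k) (pCons a p) = pCons (t k a) (map_poly (t k) p)" for a p
    by (rule map_poly_pCons_additive) (rule addt)
  show ?thesis
    by (rule sesquilinear_unique[where P = "\<lambda>p. - pCons 0 p" and Q = L
          and F = "\<lambda>x y. sesqui_ext s f x (map_poly (t k) y)"
          and G = "\<lambda>x y. map_poly (map_poly (s k)) (sesqui_ext s f x y)"];
        (rule additive.intro)?; simp add: add_s add_t pCons_t additive.zero[OF addt]
        sesqui_ext_add_left sesqui_ext_add_right sesqui_ext_der_left
        sesqui_ext_der_right coefficientwise_scale_L coefficientwise_scale_pCons
        sesqui_ext_const assms del: minus_pCons)
qed

end

lemma additive_at_neg_lam_der:
  "vector_space s \<Longrightarrow> additive (at_neg_lam_der (free_scale s))"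
  unfolding at_neg_lam_der_def
  by (intro additive_subst_op additive_uminus additive_lam_plus_der additive_const_poly)

lemma at_neg_lam_der_pCons_0:
  assumes "vector_space s"
  shows "at_neg_lam_der (free_scale s) (pCons 0 p) =
    - lam_plus_der (free_scale s) (at_neg_lam_der (free_scale s) p)"
  unfolding at_neg_lam_der_def
  by (intro subst_op_pCons_0 additive_uminus additive_lam_plus_der additive_const_poly assms)

text \<open>
  With \<open>at_neg_lam_der_pCons_0\<close>: the substitution $x := -\lambda - \partial$ sends
  $x$ to $-(\lambda + \partial)$ and $x + \partial$ to $-\lambda$. Hence exchanging the slots of a
  sesquilinear map and then substituting yields a sesquilinear map.
\<close>
lemma at_neg_lam_der_lam_plus_der:
  assumes "vector_space s"
  shows "at_neg_lam_der (free_scale s) (lam_plus_der (free_scale s) p) =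
    - pCons 0 (at_neg_lam_der (free_scale s) p)"
proof -
  let ?L = "lam_plus_der (free_scale s)" and ?d = "map_poly (pCons 0)"
  have addL: "additive (\<lambda>q. - ?L q)"
    by (intro additive_uminus additive_lam_plus_der assms)
  have addd: "additive ?d"
    by (intro additive_map_poly additive_pCons_0)
  have "?d (- ?L q) = - ?L (?d q)" for q
    by (simp add: lam_plus_der_free assms map_poly_pCons_additive additive_pCons_0
        additive.add[OF addd] additive.minus[OF addd] additive.diff[OF addd]
        del: add_pCons minus_pCons diff_pCons)
  then have "?d (at_neg_lam_der (free_scale s) p) =
      subst_op (\<lambda>q. - ?L q) (\<lambda>m. ?d [:m:]) p"
    unfolding at_neg_lam_der_def
    by (intro subst_op_apply addL addd additive_const_poly)
  also have "\<dots> = at_neg_lam_der (free_scale s) (?d p)"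
    unfolding at_neg_lam_der_def
    by (simp add: subst_op_map_poly addL additive_const_poly additive_pCons_0
        map_poly_pCons_additive)
  finally show ?thesis
    unfolding lam_plus_der_free[OF assms, of p]
      additive.add[OF additive_at_neg_lam_der[OF assms]] at_neg_lam_der_pCons_0[OF assms]
    by (simp add: lam_plus_der_free assms)
qed


section \<open>Brackets evaluated at an operator\<close>

text \<open>The action of $\partial$ on $M[\lambda,\mu]$, coefficient by coefficient, for the free module $M$.\<close>
definition der2 :: "'m::ab_group_add poly poly poly \<Rightarrow> 'm poly poly poly" where
  "der2 = map_poly (map_poly (pCons 0))"

lemma additive_der2: "additive der2"
  unfolding der2_def by (intro additive_map_poly additive_pCons_0)

lemma const2_pCons_0: "const2 (pCons 0 m) = der2 (const2 m)"
  by (simp add: const2_def der2_def map_poly_pCons_additive additive_pCons_0 additive_map_poly)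

lemma der2_mu: "der2 (mu p) = mu (der2 p)"
  by (simp add: der2_def mu_def map_poly_pCons_additive additive_pCons_0 additive_map_poly)

lemma der2_lam: "der2 (lam p) = lam (der2 p)"
  by (simp add: der2_def lam_def map_poly_map_poly_additive map_poly_pCons_additive
       additive_pCons_0 additive_map_poly)

lemma lam_mu: "lam (mu (p :: 'm::ab_group_add poly poly)) = mu (lam p)"
  by (simp add: lam_def mu_def map_poly_pCons_additive additive_pCons_0)

text \<open>
  The value $[d_X c]$ in $M[\lambda,\mu]$, obtained by replacing $\lambda$ in $[d_\lambda c]$ by an
  operator \<open>X\<close>. Keeping \<open>X\<close> abstract covers $\lambda$, $\mu$, $\lambda + \mu$ and $\mu - \lambda$
  at once.
\<close>
definition bracket_at :: "('m::ab_group_add poly poly poly \<Rightarrow> 'm poly poly poly) \<Rightarrow>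
    ('d \<Rightarrow> 'c \<Rightarrow> 'm poly poly) \<Rightarrow> 'd \<Rightarrow> 'c \<Rightarrow> 'm poly poly poly" where
  "bracket_at X R d c = subst_op X const2 (R d c)"

locale sesquilinear_at = sesquilinear_extension s f
  for s :: "'k::field_char_0 \<Rightarrow> 'w::ab_group_add \<Rightarrow> 'w"
    and f :: "'a::ab_group_add \<Rightarrow> 'v::ab_group_add \<Rightarrow> 'w poly poly" +
  fixes X :: "'w poly poly poly \<Rightarrow> 'w poly poly poly"
  assumes additive_X: "additive X"
    and der2_X: "der2 (X p) = X (der2 p)"
begin

abbreviation F :: "'a poly \<Rightarrow> 'v poly \<Rightarrow> 'w poly poly poly" where
  "F \<equiv> bracket_at X (sesqui_ext s f)"

lemma additive_subst_X: "additive (subst_op X const2)"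
  by (intro additive_subst_op additive_X additive_const2)

lemma F_additive_right: "additive (F d)"
  unfolding bracket_at_def[abs_def]
  by (rule additive_compose[OF additive_subst_X sesqui_ext_additive_right])

lemma F_additive_left: "additive (\<lambda>d. F d c)"
  unfolding bracket_at_def[abs_def]
  by (rule additive_compose[OF additive_subst_X sesqui_ext_additive_left])

lemma F_der_left: "F (pCons 0 d) c = - X (F d c)"
  by (simp add: bracket_at_def sesqui_ext_der_left additive.minus[OF additive_subst_X]
      subst_op_pCons_0 additive_X additive_const2 del: minus_pCons)

text \<open>
  Here the commutation of \<open>X\<close> with $\partial$ enters: the $\partial$ in $\lambda + \partial$ acts on
  the coefficients, before the substitution.
\<close>
lemma F_der_right: "F d (pCons 0 c) = X (F d c) + der2 (F d c)"
proof -
  have "der2 (subst_op X const2 p) = subst_op X (\<lambda>m. der2 (const2 m)) p" for p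
    by (rule subst_op_apply) (simp_all add: additive_X additive_const2 additive_der2 der2_X)
  then have "subst_op X const2 (map_poly (pCons 0) p) = der2 (subst_op X const2 p)" for p
    by (simp add: subst_op_map_poly additive_X additive_const2 additive_pCons_0 const2_pCons_0)
  then show ?thesis
    by (simp add: bracket_at_def sesqui_ext_der_right L_eq additive.add[OF additive_subst_X]
      subst_op_pCons_0 additive_X additive_const2)
qed

lemma F_const:
  assumes "f a v = [:[:p, q:], [:m:]:]"
  shows "F [:a:] [:v:] = const2 [:p:] + der2 (const2 [:q:]) + X (const2 [:m:])"
proof -
  have "const2 [:p, q:] = const2 ([:p:] + pCons 0 [:q:])"
    by simp
  also have "\<dots> = const2 [:p:] + der2 (const2 [:q:])"
    by (simp only: additive.add[OF additive_const2] const2_pCons_0)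
  finally have "const2 [:p, q:] = const2 [:p:] + der2 (const2 [:q:])" .
  then show ?thesis
    by (simp add: bracket_at_def sesqui_ext_const assms subst_op_pCons additive_X
        additive_const2 subst_op_0 additive.zero[OF additive_X])
qed

end

section \<open>Brackets of Gel'fand-Dorfman algebras and the adjoint representation\<close>

context lie_algebra
begin

lemma lie_antisym: "lie a b = - lie b a"
proof -
  have "lie (a + b) (a + b) = lie a b + lie b a"
    unfolding bilinear_map_additive[OF lie_bilinear, THEN additive.add]
    by (simp add: lie_alternating)
  then have "lie a b + lie b a = 0"
    by (simp only: lie_alternating)
  then show ?thesis
    by (rule eq_neg_iff_add_eq_0[THEN iffD2])
qed

end

context gd_algebra
begin

lemmas algebra_additive =
  bilinear_map_additive[OF circ_bilinear] bilinear_map_additive[OF lie_bilinear]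

lemmas algebra_add = algebra_additive[THEN additive.add]

lemmas algebra_scale =
  bilinear_map_scale[OF circ_bilinear] bilinear_map_scale[OF lie_bilinear]

definition alg_generators :: "'a \<Rightarrow> 'a \<Rightarrow> 'a poly poly" where
  "alg_generators a b = [:[:lie a b, b \<odot> a:], [:a \<odot> b + b \<odot> a:]:]"

lemma gd_bracket_eq: "gd_bracket sA (\<odot>) lie = sesqui_ext sA alg_generators"
  by (simp add: gd_bracket_def alg_generators_def[abs_def])

sublocale B: sesquilinear_extension sA alg_generators
  by unfold_locales (simp_all add: alg_generators_def algebra_add add_ac)

text \<open>
  The axioms of a representation are those of a Gel'fand-Dorfman algebra with one argument taken
  from the module, so they hold for \<open>A\<close> itself. This makes the Jacobi identity of the conformal
  algebra an instance of the one for representations.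
\<close>
lemma adjoint_representation: "gd_representation sA (\<odot>) lie sA (\<odot>) (\<lambda>a v. v \<odot> a) lie"
proof unfold_locales
  show "bilinear_map sA sA sA (\<lambda>a v. v \<odot> a)"
    using circ_bilinear by (simp add: bilinear_map_def)
  fix a b v
  note diffs = algebra_additive[THEN additive.diff] and minus = algebra_additive[THEN additive.minus]
  show "lie (lie a b) v = lie a (lie b v) - lie b (lie a v)"
    using lie_jacobi[of a b v] lie_antisym[of v "lie a b"] lie_antisym[of v a]
    by (simp add: minus eq_diff_eq algebra_simps)
  show "(a \<odot> b - b \<odot> a) \<odot> v = a \<odot> (b \<odot> v) - b \<odot> (a \<odot> v)"
    using left_symmetric[of a b v] by (simp add: diffs algebra_simps)
  show "a \<odot> (v \<odot> b) - a \<odot> v \<odot> b = v \<odot> (a \<odot> b) - v \<odot> a \<odot> b"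
    using left_symmetric[of a v b] by (simp add: algebra_simps)
  show "a \<odot> b \<odot> v = a \<odot> v \<odot> b" "v \<odot> b \<odot> a = v \<odot> a \<odot> b"
    by (rule right_commutative)+
  show "lie a (b \<odot> v) + lie (b \<odot> a) v + lie b a \<odot> v - lie b v \<odot> a - b \<odot> lie a v = 0"
    using gd_compatible[of b a v] lie_antisym[of a "b \<odot> v"] by (simp add: algebra_simps)
  show "lie a (v \<odot> b) - lie b (v \<odot> a) - lie a v \<odot> b + lie b v \<odot> a - v \<odot> lie a b = 0"
    using gd_compatible[of v a b] lie_antisym[of a "v \<odot> b"] lie_antisym[of b "v \<odot> a"]
      lie_antisym[of a v] lie_antisym[of b v]
    by (simp add: minus algebra_simps)
qed (fact circ_bilinear lie_bilinear)+

end

section \<open>The Jacobi identity of a representation\<close>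

context gd_representation
begin

definition rep_generators :: "'a \<Rightarrow> 'v \<Rightarrow> 'v poly poly" where
  "rep_generators a v = [:[:\<rho> a v, r a v:], [:l a v + r a v:]:]"

lemma gd_rho_eq: "gd_rho sV l r \<rho> = sesqui_ext sV rep_generators"
  by (simp add: gd_rho_def rep_generators_def[abs_def])

lemmas action_additive =
  bilinear_map_additive[OF l_bilinear] bilinear_map_additive[OF r_bilinear]
  bilinear_map_additive[OF rho_bilinear] algebra_additive

lemmas action_add = action_additive[THEN additive.add]

lemmas action_scale =
  bilinear_map_scale[OF l_bilinear] bilinear_map_scale[OF r_bilinear]
  bilinear_map_scale[OF rho_bilinear]

sublocale R: sesquilinear_extension sV rep_generators
  by unfold_locales (simp_all add: rep_generators_def action_add add_ac)

text \<open>The element $a_X(b_Y c)$, expanded along the coefficients of $b_Y c$.\<close>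
definition iterated_action :: "('v poly poly poly \<Rightarrow> 'v poly poly poly) \<Rightarrow>
    ('v poly poly poly \<Rightarrow> 'v poly poly poly) \<Rightarrow> 'a poly \<Rightarrow> 'a poly \<Rightarrow> 'v poly \<Rightarrow>
    'v poly poly poly" where
  "iterated_action X Y a b c = subst_op Y (bracket_at X (gd_rho sV l r \<rho>) a) (gd_rho sV l r \<rho> b c)"

text \<open>The element $[a_X b]_Z\, c$, expanded along the coefficients of $[a_X b]$; it is used with $Z = X + Y$.\<close>
definition bracket_action :: "('v poly poly poly \<Rightarrow> 'v poly poly poly) \<Rightarrow>
    ('v poly poly poly \<Rightarrow> 'v poly poly poly) \<Rightarrow> 'a poly \<Rightarrow> 'a poly \<Rightarrow> 'v poly \<Rightarrow>
    'v poly poly poly" where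
  "bracket_action X Z a b c =
     subst_op X (\<lambda>d. bracket_at Z (gd_rho sV l r \<rho>) d c) (gd_bracket sA (\<odot>) lie a b)"

end

text \<open>
  Since \<open>X\<close> and \<open>Y\<close> need not be indeterminates but only commuting operators, no change of variables
  is needed to pass from the Jacobi identity, at $\lambda$ and $\mu$, to the bracket in
  $\mathrm{gc}(M)$, at $\lambda$ and $\mu - \lambda$.
\<close>
locale gd_representation_at = gd_representation sA circ lie sV l r \<rho>
  for sA :: "'k::field_char_0 \<Rightarrow> 'a::ab_group_add \<Rightarrow> 'a"
    and circ :: "'a \<Rightarrow> 'a \<Rightarrow> 'a"  (infixl "\<odot>" 70)
    and lie :: "'a \<Rightarrow> 'a \<Rightarrow> 'a"
    and sV :: "'k \<Rightarrow> 'v::ab_group_add \<Rightarrow> 'v"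
    and l r \<rho> :: "'a \<Rightarrow> 'v \<Rightarrow> 'v" +
  fixes X Y :: "'v poly poly poly \<Rightarrow> 'v poly poly poly"
  assumes additive_X: "additive X" and additive_Y: "additive Y"
    and der2_X: "der2 (X p) = X (der2 p)" and der2_Y: "der2 (Y p) = Y (der2 p)"
    and X_Y: "X (Y p) = Y (X p)"
begin

sublocale FX: sesquilinear_at sV rep_generators X
  by unfold_locales (simp_all add: additive.add[OF additive_X] der2_X)

sublocale FY: sesquilinear_at sV rep_generators Y
  by unfold_locales (simp_all add: additive.add[OF additive_Y] der2_Y)

definition "Z p = X p + Y p"

lemma additive_Z: "additive Z"
  unfolding Z_def[abs_def] by (intro additive_plus additive_X additive_Y)

sublocale FZ: sesquilinear_at sV rep_generators Z
  by unfold_locales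
    (simp_all add: Z_def additive.add[OF additive_X] additive.add[OF additive_Y]
       additive.add[OF additive_der2] der2_X der2_Y add_ac)

lemma iterated_action_eq: "iterated_action X Y a b c = subst_op Y (FX.F a) (sesqui_ext sV rep_generators b c)"
  by (simp add: iterated_action_def gd_rho_eq)

lemma iterated_action_additive:
  "additive (\<lambda>a. iterated_action X Y a b c)"
  "additive (\<lambda>b. iterated_action X Y a b c)"
  "additive (\<lambda>c. iterated_action X Y a b c)"
proof -
  have outer: "additive (subst_op Y (FX.F a))" for a
    by (intro additive_subst_op additive_Y FX.F_additive_right)
  show "additive (\<lambda>a. iterated_action X Y a b c)"
    unfolding iterated_action_eq
    by (rule additive_subst_op_fun[where e = "\<lambda>a d. FX.F a d"])
      (rule additive_Y FX.F_additive_left FX.F_additive_right)+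
  show "additive (\<lambda>b. iterated_action X Y a b c)"
    unfolding iterated_action_eq by (rule additive_compose[OF outer R.sesqui_ext_additive_left])
  show "additive (\<lambda>c. iterated_action X Y a b c)"
    unfolding iterated_action_eq[abs_def] by (rule additive_compose[OF outer R.sesqui_ext_additive_right])
qed

text \<open>
  In $a_X(b_Y c)$ a derivative of $c$ first becomes $Y + \partial$, and this inner $\partial$ becomes
  $X + \partial$.
\<close>
lemma iterated_action_der:
  "iterated_action X Y (pCons 0 a) b c = - X (iterated_action X Y a b c)"
  "iterated_action X Y a (pCons 0 b) c = - Y (iterated_action X Y a b c)"
  "iterated_action X Y a b (pCons 0 c) =
     X (iterated_action X Y a b c) + Y (iterated_action X Y a b c) + der2 (iterated_action X Y a b c)"
proof -
  have outer: "additive (subst_op Y (FX.F a))"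
    by (intro additive_subst_op additive_Y FX.F_additive_right)
  have subst_X: "subst_op Y (\<lambda>d. X (FX.F a d)) p = X (subst_op Y (FX.F a) p)" for p
    by (rule subst_op_apply[symmetric])
      (simp_all add: additive_X additive_Y FX.F_additive_right X_Y)
  have subst_der: "subst_op Y (\<lambda>d. der2 (FX.F a d)) p = der2 (subst_op Y (FX.F a) p)" for p
    by (rule subst_op_apply[symmetric])
      (simp_all add: additive_der2 additive_Y FX.F_additive_right der2_Y)
  note addX = additive_compose[OF additive_X FX.F_additive_right]
    and addD = additive_compose[OF additive_der2 FX.F_additive_right]
  show "iterated_action X Y (pCons 0 a) b c = - X (iterated_action X Y a b c)"
    unfolding iterated_action_eq FX.F_der_left[abs_def]
    by (simp add: subst_op_uminus_fun additive_Y addX subst_X)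
  show "iterated_action X Y a (pCons 0 b) c = - Y (iterated_action X Y a b c)"
    unfolding iterated_action_eq
    by (simp add: R.sesqui_ext_der_left additive.minus[OF outer] subst_op_pCons_0 additive_Y
        FX.F_additive_right del: minus_pCons)
  show "iterated_action X Y a b (pCons 0 c) =
     X (iterated_action X Y a b c) + Y (iterated_action X Y a b c) + der2 (iterated_action X Y a b c)"
    unfolding iterated_action_eq
    by (simp add: R.sesqui_ext_der_right R.L_eq additive.add[OF outer] subst_op_pCons_0
        additive_Y FX.F_additive_right subst_op_map_poly additive_pCons_0 FX.F_der_right
        subst_op_plus_fun addX addD subst_X subst_der add_ac)
qed

lemma bracket_action_eq:
  "bracket_action X Z a b c = subst_op X (\<lambda>d. FZ.F d c) (sesqui_ext sA alg_generators a b)"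
  by (simp add: bracket_action_def gd_rho_eq gd_bracket_eq)

lemma X_Z: "X (Z p) = Z (X p)"
  by (simp add: Z_def additive.add[OF additive_X] X_Y)

lemma bracket_action_additive:
  "additive (\<lambda>a. bracket_action X Z a b c)"
  "additive (\<lambda>b. bracket_action X Z a b c)"
  "additive (\<lambda>c. bracket_action X Z a b c)"
proof -
  have outer: "additive (subst_op X (\<lambda>d. FZ.F d c))" for c
    by (intro additive_subst_op additive_X FZ.F_additive_left)
  show "additive (\<lambda>c. bracket_action X Z a b c)"
    unfolding bracket_action_eq[abs_def]
    by (rule additive_subst_op_fun[where e = "\<lambda>c d. FZ.F d c"])
      (rule additive_X FZ.F_additive_left FZ.F_additive_right)+
  show "additive (\<lambda>a. bracket_action X Z a b c)"
    unfolding bracket_action_eq by (rule additive_compose[OF outer B.sesqui_ext_additive_left])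
  show "additive (\<lambda>b. bracket_action X Z a b c)"
    unfolding bracket_action_eq by (rule additive_compose[OF outer B.sesqui_ext_additive_right])
qed

text \<open>
  The same rules as for $a_X(b_Y c)$: a derivative of $b$ becomes $X + \partial$ inside the bracket,
  and that $\partial$, now in the first slot, becomes $-(X + Y)$, which leaves $-Y$.
\<close>
lemma bracket_action_der:
  "bracket_action X Z (pCons 0 a) b c = - X (bracket_action X Z a b c)"
  "bracket_action X Z a (pCons 0 b) c = - Y (bracket_action X Z a b c)"
  "bracket_action X Z a b (pCons 0 c) =
     X (bracket_action X Z a b c) + Y (bracket_action X Z a b c) + der2 (bracket_action X Z a b c)"
proof -
  have outer: "additive (subst_op X (\<lambda>d. FZ.F d c))"
    by (intro additive_subst_op additive_X FZ.F_additive_left)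
  have subst_Z: "subst_op X (\<lambda>d. Z (FZ.F d c)) p = Z (subst_op X (\<lambda>d. FZ.F d c) p)" for p
    by (rule subst_op_apply[symmetric])
      (simp_all add: additive_X additive_Z FZ.F_additive_left X_Z)
  have subst_der: "subst_op X (\<lambda>d. der2 (FZ.F d c)) p = der2 (subst_op X (\<lambda>d. FZ.F d c) p)" for p
    by (rule subst_op_apply[symmetric])
      (simp_all add: additive_der2 additive_X FZ.F_additive_left der2_X)
  note addZ = additive_compose[OF additive_Z FZ.F_additive_left]
    and addD = additive_compose[OF additive_der2 FZ.F_additive_left]
  have subst_neg: "subst_op X (\<lambda>d. FZ.F (pCons 0 d) c) p = - Z (subst_op X (\<lambda>d. FZ.F d c) p)"
    for p
    by (simp only: FZ.F_der_left subst_op_uminus_fun[OF additive_X addZ] subst_Z)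
  show "bracket_action X Z (pCons 0 a) b c = - X (bracket_action X Z a b c)"
    unfolding bracket_action_eq
    by (simp add: B.sesqui_ext_der_left additive.minus[OF outer] subst_op_pCons_0 additive_X
        FZ.F_additive_left del: minus_pCons)
  show "bracket_action X Z a (pCons 0 b) c = - Y (bracket_action X Z a b c)"
    unfolding bracket_action_eq
    by (simp add: B.sesqui_ext_der_right B.L_eq additive.add[OF outer] subst_op_pCons_0
        additive_X FZ.F_additive_left subst_op_map_poly additive_pCons_0 subst_neg)
      (simp add: Z_def)
  show "bracket_action X Z a b (pCons 0 c) =
     X (bracket_action X Z a b c) + Y (bracket_action X Z a b c) + der2 (bracket_action X Z a b c)"
    unfolding bracket_action_eq
    by (simp add: FZ.F_der_right subst_op_plus_fun additive_X addZ addD subst_Z subst_der)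
      (simp add: Z_def)
qed


definition K :: "'v \<Rightarrow> 'v poly poly poly" where
  "K v = const2 [:v:]"

lemma additive_K: "additive K"
  unfolding K_def[abs_def] by (rule additive_compose[OF additive_const2 additive_const_poly])

lemma eval_const:
  "FX.F [:a:] [:v:] = K (\<rho> a v) + der2 (K (r a v)) + X (K (l a v + r a v))"
  "FY.F [:a:] [:v:] = K (\<rho> a v) + der2 (K (r a v)) + Y (K (l a v + r a v))"
  "FZ.F [:a:] [:v:] = K (\<rho> a v) + der2 (K (r a v)) + Z (K (l a v + r a v))"
  unfolding K_def
  by (rule FX.F_const FY.F_const FZ.F_const; rule rep_generators_def)+

lemma iterated_action_const:
  "iterated_action X Y [:a:] [:b:] [:c:] = FX.F [:a:] [:\<rho> b c:] + X (FX.F [:a:] [:r b c:])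
     + der2 (FX.F [:a:] [:r b c:]) + Y (FX.F [:a:] [:l b c + r b c:])"
proof -
  have "[:\<rho> b c, r b c:] = [:\<rho> b c:] + pCons 0 [:r b c:]" by simp
  then have "FX.F [:a:] [:\<rho> b c, r b c:] =
      FX.F [:a:] [:\<rho> b c:] + (X (FX.F [:a:] [:r b c:]) + der2 (FX.F [:a:] [:r b c:]))"
    by (simp only: additive.add[OF FX.F_additive_right] FX.F_der_right)
  then show ?thesis
    by (simp add: iterated_action_eq R.sesqui_ext_const rep_generators_def subst_op_pCons additive_Y
        FX.F_additive_right subst_op_0 additive.zero[OF additive_Y])
qed

lemma bracket_action_const:
  "bracket_action X Z [:a:] [:b:] [:c:] = FZ.F [:lie a b:] [:c:] - Z (FZ.F [:b \<odot> a:] [:c:])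
     + X (FZ.F [:a \<odot> b + b \<odot> a:] [:c:])"
proof -
  have "[:lie a b, b \<odot> a:] = [:lie a b:] + pCons 0 [:b \<odot> a:]" by simp
  then have "FZ.F [:lie a b, b \<odot> a:] [:c:] = FZ.F [:lie a b:] [:c:] - Z (FZ.F [:b \<odot> a:] [:c:])"
    by (simp only: additive.add[OF FZ.F_additive_left] FZ.F_der_left) simp
  then show ?thesis
    by (simp add: bracket_action_eq B.sesqui_ext_const alg_generators_def subst_op_pCons additive_X
        FZ.F_additive_left subst_op_0 additive.zero[OF additive_X])
qed

lemma swapped: "gd_representation_at sA (\<odot>) lie sV l r \<rho> Y X"
  by unfold_locales
    (simp_all add: der2_X der2_Y X_Y additive.add[OF additive_X] additive.add[OF additive_Y])

text \<open>
  On generators both sides are combinations of the monomials $1$, $\partial$, $X$, $Y$,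
  $\partial^2$, $X\partial$, $Y\partial$, $X^2$, $XY$, $Y^2$ with coefficients in \<open>V\<close>, and
  all ten coefficients of the difference vanish.
\<close>
lemma jacobi_const:
  "iterated_action X Y [:a:] [:b:] [:c:] =
     bracket_action X Z [:a:] [:b:] [:c:] + iterated_action Y X [:b:] [:a:] [:c:]"
proof -
  define s where "s x v = l x v + r x v" for x v
  interpret swap: gd_representation_at sA "(\<odot>)" lie sV l r \<rho> Y X
    by (rule swapped)
  have lie_ba: "l (lie b a) c = - l (lie a b) c"
    by (simp add: lie_antisym[of b a] additive.minus[OF bilinear_map_additive(2)[OF l_bilinear]])
  have ll: "l a (l b c) = l b (l a c) + l (a \<odot> b) c - l (b \<odot> a) c"
    using rep_l_commutator[of a b c]
    by (simp add: additive.diff[OF bilinear_map_additive(2)[OF l_bilinear]] algebra_simps)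
  have lr: "l x (r y c) = r y (l x c) + r (x \<odot> y) c - r y (r x c)" for x y
    using rep_l_r[of x y c] by (simp add: algebra_simps)
  have rr: "r a (r b c) = r b (r a c)"
    by (rule rep_r_r)
  have rho_lie': "\<rho> (lie a b) c = \<rho> a (\<rho> b c) - \<rho> b (\<rho> a c)"
    by (rule rho_lie)
  have r_lie: "r (lie a b) c = \<rho> a (r b c) - \<rho> b (r a c) - r b (\<rho> a c) + r a (\<rho> b c)"
    using rep_gd_2[of a b c] by (simp add: algebra_simps)
  have l_lie: "l (lie a b) c = r b (\<rho> a c) + l a (\<rho> b c) - \<rho> b (l a c) - \<rho> (a \<odot> b) c"
    using rep_gd_1[of b a c] by (simp add: algebra_simps)
  have rho_l: "\<rho> a (l b c) = l (lie a b) c + r a (\<rho> b c) + l b (\<rho> a c) - \<rho> (b \<odot> a) c"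
    using rep_gd_1[of a b c] by (simp add: lie_ba algebra_simps)
  note identities = s_def action_add ll lr rr rho_lie' r_lie rho_l l_lie rep_l_circ
  \<comment> \<open>The coefficients in the order of the monomials above. The axioms, solved for one term each as
    above, bring every coefficient to a normal form.\<close>
  have t1: "\<rho> a (\<rho> b c) - \<rho> (lie a b) c - \<rho> b (\<rho> a c) = 0" (is "?t1 = 0")
    by (simp add: identities)
  have t2: "r a (\<rho> b c) + \<rho> a (r b c) - r (lie a b) c - r b (\<rho> a c) - \<rho> b (r a c) = 0" (is "?t2 = 0")
    by (simp add: identities)
  have t3: "s a (\<rho> b c) + \<rho> a (r b c) - s (lie a b) c - \<rho> (a \<odot> b) c - \<rho> b (s a c) = 0" (is "?t3 = 0")
    by (simp add: identities)
  have t4: "\<rho> a (s b c) - s (lie a b) c + \<rho> (b \<odot> a) c - s b (\<rho> a c) - \<rho> b (r a c) = 0" (is "?t4 = 0")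
    by (simp add: identities)
  have t5: "r a (r b c) - r b (r a c) = 0" (is "?t5 = 0")
    by (simp add: identities)
  have t6: "r a (r b c) + s a (r b c) - r (a \<odot> b) c - r b (s a c) = 0" (is "?t6 = 0")
    by (simp add: identities)
  have t7: "r a (s b c) + r (b \<odot> a) c - r b (r a c) - s b (r a c) = 0" (is "?t7 = 0")
    by (simp add: identities)
  have t8: "s a (r b c) - s (a \<odot> b) c = 0" (is "?t8 = 0")
    by (simp add: identities)
  have t9: "s a (s b c) - s (a \<odot> b) c + s (b \<odot> a) c - s b (s a c) = 0" (is "?t9 = 0")
    by (simp add: identities)
  have t10: "s (b \<odot> a) c - s b (r a c) = 0" (is "?t10 = 0")
    by (simp add: identities)
  note additivity = additive_X[THEN additive.add] additive_Y[THEN additive.add]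
    additive_der2[THEN additive.add] additive_K[THEN additive.add]
    additive_X[THEN additive.diff] additive_Y[THEN additive.diff]
    additive_der2[THEN additive.diff] additive_K[THEN additive.diff]
  have "iterated_action X Y [:a:] [:b:] [:c:] - bracket_action X Z [:a:] [:b:] [:c:]
        - iterated_action Y X [:b:] [:a:] [:c:] =
      K ?t1 + der2 (K ?t2) + X (K ?t3) + Y (K ?t4) + der2 (der2 (K ?t5)) + X (der2 (K ?t6))
        + Y (der2 (K ?t7)) + X (X (K ?t8)) + Y (X (K ?t9)) + Y (Y (K ?t10))"
    unfolding iterated_action_const swap.iterated_action_const bracket_action_const eval_const
    by (simp add: Z_def s_def action_add additivity der2_X der2_Y X_Y algebra_simps)
  also have "\<dots> = 0"
    unfolding t1 t2 t3 t4 t5 t6 t7 t8 t9 t10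
    by (simp add: additive_X[THEN additive.zero] additive_Y[THEN additive.zero]
       additive_der2[THEN additive.zero] additive_K[THEN additive.zero])
  finally show ?thesis
    by (simp add: algebra_simps)
qed

lemma jacobi:
  "iterated_action X Y a b c = bracket_action X Z a b c + iterated_action Y X b a c"
proof -
  interpret swap: gd_representation_at sA "(\<odot>)" lie sV l r \<rho> Y X
    by (rule swapped)
  let ?J = "\<lambda>a b c. bracket_action X Z a b c + iterated_action Y X b a c"
  note add = additive.add[OF additive_X] additive.add[OF additive_Y] additive.add[OF additive_der2]
  \<comment> \<open>Generators are replaced by polynomials one slot at a time, starting with the last.\<close>
  have const_ab: "iterated_action X Y [:a:] [:b:] c = ?J [:a:] [:b:] c" for a b
    by (rule poly_additive_ext[where D = "\<lambda>p. X p + Y p + der2 p" and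
          f = "\<lambda>c. iterated_action X Y [:a:] [:b:] c" and g = "?J [:a:] [:b:]"])
      (simp_all only: additive_plus iterated_action_additive bracket_action_additive
        swap.iterated_action_additive jacobi_const iterated_action_der bracket_action_der swap.iterated_action_der
        add, simp_all add: add_ac)
  have const_a: "iterated_action X Y [:a:] b c = ?J [:a:] b c" for a
    by (rule poly_additive_ext[where D = "\<lambda>p. - Y p" and
          f = "\<lambda>b. iterated_action X Y [:a:] b c" and g = "\<lambda>b. ?J [:a:] b c"])
      (simp_all only: additive_plus iterated_action_additive bracket_action_additive
        swap.iterated_action_additive const_ab iterated_action_der bracket_action_der swap.iterated_action_der
        add, simp_all)
  show ?thesis
    by (rule poly_additive_ext[where D = "\<lambda>p. - X p" and
          f = "\<lambda>a. iterated_action X Y a b c" and g = "\<lambda>a. ?J a b c"])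
      (simp_all only: additive_plus iterated_action_additive bracket_action_additive
        swap.iterated_action_additive const_a iterated_action_der bracket_action_der swap.iterated_action_der
        add, simp_all)
qed

end

section \<open>The conformal algebra, its representation and its operators\<close>

lemma at_neg_lam_der_linear:
  assumes "vector_space s"
  shows "at_neg_lam_der (free_scale s) [:[:p, q:], [:m:]:] = [:[:p, q - m:], [:- m:]:]"
proof -
  have "at_neg_lam_der (free_scale s) [:[:p, q:], [:m:]:] =
      [:[:p, q:]:] - lam_plus_der (free_scale s) [:[:m:]:]"
    using additive_uminus[OF additive_lam_plus_der[OF assms]]
    by (simp add: at_neg_lam_der_def subst_op_pCons additive_const_poly subst_op_0
        lam_plus_der_free assms)
  then show ?thesis
    by (simp add: lam_plus_der_free assms map_poly_pCons)
qed

lemma indeterminates_representation_at: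
  assumes "gd_representation sA circ lie sV l r \<rho>"
  shows "gd_representation_at sA circ lie sV l r \<rho> lam mu"
    and "gd_representation_at sA circ lie sV l r \<rho> lam (\<lambda>p. mu p - lam p)"
proof -
  note ops = additive.add[OF additive_mu] additive.add[OF additive_lam]
    additive.diff[OF additive_lam] additive.diff[OF additive_der2] der2_mu der2_lam lam_mu
  show "gd_representation_at sA circ lie sV l r \<rho> lam mu"
    by (intro gd_representation_at.intro assms gd_representation_at_axioms.intro additive.intro)
      (simp_all add: ops)
  show "gd_representation_at sA circ lie sV l r \<rho> lam (\<lambda>p. mu p - lam p)"
    by (intro gd_representation_at.intro assms gd_representation_at_axioms.intro additive.intro)
      (simp_all add: ops)
qed

context gd_algebra
begin

text \<open>
  Both sides are sesquilinear; on generators, $-[b_{-\lambda-\partial}a]$ has the coefficient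
  $-a \circ b + a \star b = b \circ a$ at $\partial$.
\<close>
lemma bracket_skew:
  "gd_bracket sA (\<odot>) lie x y = - at_neg_lam_der (free_scale sA) (gd_bracket sA (\<odot>) lie y x)"
proof -
  let ?N = "at_neg_lam_der (free_scale sA)"
  note addN = additive_at_neg_lam_der[OF B.vector_space_s]
  show ?thesis
    unfolding gd_bracket_eq
  proof (rule sesquilinear_unique[where P = "\<lambda>p. - pCons 0 p" and Q = B.L
          and F = "sesqui_ext sA alg_generators"
          and G = "\<lambda>x y. - ?N (sesqui_ext sA alg_generators y x)"])
    show "additive (sesqui_ext sA alg_generators x)"
      "additive (\<lambda>x. sesqui_ext sA alg_generators x y)" for x y
      by (rule B.sesqui_ext_additive_right B.sesqui_ext_additive_left)+
    show "additive (\<lambda>y. - ?N (sesqui_ext sA alg_generators y x))"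
      "additive (\<lambda>x. - ?N (sesqui_ext sA alg_generators y x))" for x y
      by (rule additive_uminus, rule additive_compose[OF addN],
          rule B.sesqui_ext_additive_right B.sesqui_ext_additive_left)+
    show "sesqui_ext sA alg_generators (pCons 0 x) y = - pCons 0 (sesqui_ext sA alg_generators x y)"
      "sesqui_ext sA alg_generators x (pCons 0 y) = B.L (sesqui_ext sA alg_generators x y)" for x y
      by (rule B.sesqui_ext_der_left B.sesqui_ext_der_right)+
    show "- ?N (sesqui_ext sA alg_generators y (pCons 0 x)) =
        - pCons 0 (- ?N (sesqui_ext sA alg_generators y x))" for x y
      by (simp add: B.sesqui_ext_der_right at_neg_lam_der_lam_plus_der[OF B.vector_space_s])
    show "- ?N (sesqui_ext sA alg_generators (pCons 0 y) x) =
        B.L (- ?N (sesqui_ext sA alg_generators y x))" for x y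
      by (simp add: B.sesqui_ext_der_left additive.minus[OF addN] additive.minus[OF B.additive_L]
          at_neg_lam_der_pCons_0[OF B.vector_space_s] del: minus_pCons)
    show "sesqui_ext sA alg_generators [:a:] [:b:] =
        - ?N (sesqui_ext sA alg_generators [:b:] [:a:])" for a b
      by (simp add: B.sesqui_ext_const alg_generators_def lie_antisym[of b a]
          at_neg_lam_der_linear[OF B.vector_space_s])
  qed
qed

lemma bracket_jacobi:
  fixes a b c :: "'a poly"
  defines "br \<equiv> gd_bracket sA (\<odot>) lie"
  shows "subst_op mu (\<lambda>d. subst_op lam const2 (br a d)) (br b c) =
       subst_op lam (\<lambda>d. subst_op (\<lambda>p. lam p + mu p) const2 (br d c)) (br a b) +
       subst_op lam (\<lambda>d. subst_op mu const2 (br b d)) (br a c)"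
proof -
  interpret adj: gd_representation_at sA "(\<odot>)" lie sA "(\<odot>)" "\<lambda>a v. v \<odot> a" lie lam mu
    by (rule indeterminates_representation_at(1)) (rule adjoint_representation)
  have br: "gd_rho sA (\<odot>) (\<lambda>a v. v \<odot> a) lie = br"
    by (simp add: br_def gd_rho_def gd_bracket_def)
  show ?thesis
    using adj.jacobi[of a b c]
    unfolding adj.iterated_action_def adj.bracket_action_def br br_def[symmetric]
      bracket_at_def[abs_def] adj.Z_def[abs_def] .
qed

lemma lie_conformal_algebra: "lie_conformal_algebra (free_scale sA) (gd_bracket sA (\<odot>) lie)"
proof (intro lie_conformal_algebra.intro lie_conformal_algebra_axioms.intro)
  note vs = B.vector_space_s
  note zero = additive.zero[OF additive_scale[OF vs]]
  have scale_left: "alg_generators (sA k a) b = map_poly (map_poly (sA k)) (alg_generators a b)"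
    and scale_right: "alg_generators a (sA k b) = map_poly (map_poly (sA k)) (alg_generators a b)"
    for k a b
    by (simp_all add: alg_generators_def algebra_scale map_poly_pCons zero
        additive.add[OF additive_scale[OF vs]])
  show "module (free_scale sA)"
    by (rule module_free_scale[OF vs])
  fix a b c :: "'a poly" and k
  show "gd_bracket sA (\<odot>) lie (a + b) c = gd_bracket sA (\<odot>) lie a c + gd_bracket sA (\<odot>) lie b c"
    "gd_bracket sA (\<odot>) lie a (b + c) = gd_bracket sA (\<odot>) lie a b + gd_bracket sA (\<odot>) lie a c"
    unfolding gd_bracket_eq by (rule B.sesqui_ext_add_left B.sesqui_ext_add_right)+
  show "gd_bracket sA (\<odot>) lie (const_act (free_scale sA) k a) b =
      map_poly (const_act (free_scale sA) k) (gd_bracket sA (\<odot>) lie a b)"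
    unfolding gd_bracket_eq const_act_free_scale
    by (rule B.sesqui_ext_scale_left[OF vs scale_left])
  show "gd_bracket sA (\<odot>) lie a (const_act (free_scale sA) k b) =
      map_poly (const_act (free_scale sA) k) (gd_bracket sA (\<odot>) lie a b)"
    unfolding gd_bracket_eq const_act_free_scale
    by (rule B.sesqui_ext_scale_right[OF vs scale_right])
  show "gd_bracket sA (\<odot>) lie (der (free_scale sA) a) b = - pCons 0 (gd_bracket sA (\<odot>) lie a b)"
    "gd_bracket sA (\<odot>) lie a (der (free_scale sA) b) =
      lam_plus_der (free_scale sA) (gd_bracket sA (\<odot>) lie a b)"
    unfolding gd_bracket_eq der_free_scale[OF vs]
    by (rule B.sesqui_ext_der_left B.sesqui_ext_der_right)+
qed (fact bracket_skew bracket_jacobi)+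

end

context gd_representation
begin

text \<open>
  Since $\lambda + (\mu - \lambda) = \mu$, the general identity at $\lambda$ and $\mu - \lambda$ is the
  formula for the bracket in $\mathrm{gc}(M)$.
\<close>
lemma rho_bracket_free:
  "subst_op lam (\<lambda>d. subst_op mu const2 (gd_rho sV l r \<rho> d v)) (gd_bracket sA (\<odot>) lie a b) =
     gc_bracket (gd_rho sV l r \<rho> a) (gd_rho sV l r \<rho> b) v"
proof -
  interpret at: gd_representation_at sA "(\<odot>)" lie sV l r \<rho> lam "\<lambda>p. mu p - lam p"
    by (rule indeterminates_representation_at(2)) unfold_locales
  have "at.Z = mu"
    by (simp add: fun_eq_iff at.Z_def)
  then show ?thesis
    using at.jacobi[of a b v]
    unfolding iterated_action_def bracket_action_def bracket_at_def[abs_def] gc_bracket_def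
    by (simp only: add_diff_cancel_right')
qed

lemma conformal_representation:
  "conformal_representation (free_scale sA) (gd_bracket sA (\<odot>) lie)
     (free_scale sV) (gd_rho sV l r \<rho>)"
proof (intro conformal_representation.intro conformal_representation_axioms.intro)
  note vsA = B.vector_space_s and vs = R.vector_space_s
  note zero = additive.zero[OF additive_scale[OF vs]]
  have scale_left: "rep_generators (sA k a) v = map_poly (map_poly (sV k)) (rep_generators a v)"
    and scale_right: "rep_generators a (sV k v) = map_poly (map_poly (sV k)) (rep_generators a v)"
    for k a v
    by (simp_all add: rep_generators_def action_scale map_poly_pCons zero
        additive.add[OF additive_scale[OF vs]])
  show "lie_conformal_algebra (free_scale sA) (gd_bracket sA (\<odot>) lie)"
    by (rule lie_conformal_algebra)
  show "module (free_scale sV)"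
    by (rule module_free_scale[OF vs])
  show "\<exists>S. finite S \<and> module.span (free_scale sV) S = UNIV"
    by (rule free_module_finitely_generated) unfold_locales
  fix a b :: "'a poly" and v :: "'v poly" and k
  show "gd_rho sV l r \<rho> a \<in> gc (free_scale sV)"
    by (simp add: gc_def gd_rho_eq const_act_free_scale der_free_scale[OF vs]
        R.sesqui_ext_add_right R.sesqui_ext_der_right R.sesqui_ext_scale_right[OF vs scale_right])
  show "gd_rho sV l r \<rho> (a + b) v = gd_rho sV l r \<rho> a v + gd_rho sV l r \<rho> b v"
    unfolding gd_rho_eq by (rule R.sesqui_ext_add_left)
  show "gd_rho sV l r \<rho> (const_act (free_scale sA) k a) v =
      map_poly (const_act (free_scale sV) k) (gd_rho sV l r \<rho> a v)"
    unfolding gd_rho_eq const_act_free_scale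
    by (rule R.sesqui_ext_scale_left[OF vsA scale_left])
  show "gd_rho sV l r \<rho> (der (free_scale sA) a) v = - pCons 0 (gd_rho sV l r \<rho> a v)"
    unfolding gd_rho_eq der_free_scale[OF vsA] by (rule R.sesqui_ext_der_left)
qed (fact rho_bracket_free)

text \<open>
  The three conjuncts are the coefficients at $1$, $\partial$ and $\lambda$. On the right-hand side
  $\rho(T(v))_{-\lambda-\partial}u$ contributes $r_A(T(v))u - (l_A(T(v))u + r_A(T(v))u) =
  -l_A(T(v))u$ at $\partial$.
\<close>
lemma conformal_O_operator_on_constants:
  assumes "additive T"
  shows "gd_bracket sA (\<odot>) lie (free_ext T [:u:]) (free_ext T [:v:]) =
      map_poly (free_ext T) (gd_rho sV l r \<rho> (free_ext T [:u:]) [:v:] -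
        at_neg_lam_der (free_scale sV) (gd_rho sV l r \<rho> (free_ext T [:v:]) [:u:]))
    \<longleftrightarrow> lie (T u) (T v) = T (\<rho> (T u) v - \<rho> (T v) u) \<and>
      T v \<odot> T u = T (l (T v) u + r (T u) v) \<and>
      T u \<odot> T v + T v \<odot> T u = T (l (T u) v + r (T v) u) + T (l (T v) u + r (T u) v)"
  by (simp add: free_ext_def map_poly_pCons_additive additive_map_poly assms gd_bracket_eq gd_rho_eq
      B.sesqui_ext_const R.sesqui_ext_const alg_generators_def rep_generators_def
      at_neg_lam_der_linear[OF R.vector_space_s] additive.add[OF assms] additive.diff[OF assms] additive.minus[OF assms]
      algebra_simps)

lemma conformal_O_operator_from_constants:
  assumes T: "additive T"
    and const: "\<And>u v. gd_bracket sA (\<odot>) lie (free_ext T [:u:]) (free_ext T [:v:]) =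
      map_poly (free_ext T) (gd_rho sV l r \<rho> (free_ext T [:u:]) [:v:] -
        at_neg_lam_der (free_scale sV) (gd_rho sV l r \<rho> (free_ext T [:v:]) [:u:]))"
  shows "gd_bracket sA (\<odot>) lie (free_ext T u) (free_ext T v) =
      map_poly (free_ext T) (gd_rho sV l r \<rho> (free_ext T u) v -
        at_neg_lam_der (free_scale sV) (gd_rho sV l r \<rho> (free_ext T v) u))"
proof -
  let ?E = "free_ext T" and ?N = "at_neg_lam_der (free_scale sV)"
  let ?B = "sesqui_ext sA alg_generators" and ?R = "sesqui_ext sV rep_generators"
  note vs = R.vector_space_s
  note addN = additive_at_neg_lam_der[OF vs]
  have addE: "additive ?E"
    unfolding free_ext_def by (intro additive_map_poly T)
  have addM: "additive (map_poly ?E)"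
    by (intro additive_map_poly addE)
  have E_pCons: "?E (pCons 0 x) = pCons 0 (?E x)" for x
    by (simp add: free_ext_def map_poly_pCons_additive T additive.zero[OF T])
  have M_pCons: "map_poly ?E (pCons 0 p) = pCons 0 (map_poly ?E p)" for p
    by (simp add: map_poly_pCons_additive addE additive.zero[OF addE])
  have M_L: "map_poly ?E (R.L p) = B.L (map_poly ?E p)" for p
    by (simp add: R.L_eq B.L_eq additive.add[OF addM] M_pCons map_poly_map_poly_additive addE
        additive_pCons_0 E_pCons)
  note additivity = additive.add[OF addE] additive.add[OF addM] additive.diff[OF addM]
    additive.minus[OF addM] additive.add[OF addN] additive.minus[OF addN]
    B.sesqui_ext_add_left B.sesqui_ext_add_right R.sesqui_ext_add_left R.sesqui_ext_add_right
    additive.diff[OF additive_pCons_0]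
  note sesquilinearity = E_pCons B.sesqui_ext_der_left B.sesqui_ext_der_right
    R.sesqui_ext_der_left R.sesqui_ext_der_right M_L M_pCons
    at_neg_lam_der_lam_plus_der[OF vs] at_neg_lam_der_pCons_0[OF vs]
  have "?B (?E u) (?E v) = map_poly ?E (?R (?E u) v - ?N (?R (?E v) u))"
  proof (rule sesquilinear_unique[where P = "\<lambda>p. - pCons 0 p" and Q = B.L
          and F = "\<lambda>u v. ?B (?E u) (?E v)"
          and G = "\<lambda>u v. map_poly ?E (?R (?E u) v - ?N (?R (?E v) u))"])
    show "?B (?E [:u:]) (?E [:v:]) = map_poly ?E (?R (?E [:u:]) [:v:] - ?N (?R (?E [:v:]) [:u:]))"
      for u v
      using const[of u v] by (simp add: gd_bracket_eq gd_rho_eq)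
  qed ((rule additive.intro)?; simp add: additivity sesquilinearity
        additive.diff[OF B.additive_L] del: add_pCons minus_pCons diff_pCons)+
  then show ?thesis
    by (simp add: gd_bracket_eq gd_rho_eq)
qed

end

lemma module_hom_free_ext:
  assumes "Vector_Spaces.linear s t T"
  shows "module_hom (free_scale s) (free_scale t) (free_ext T)"
proof -
  interpret Vector_Spaces.linear s t T by fact
  have vs: "vector_space s" "vector_space t"
    by unfold_locales
  have T: "additive T"
    by (simp add: additive_def add)
  have "map_poly T (map_poly (s c) x) = map_poly (t c) (map_poly T x)" for c x
    by (simp add: map_poly_map_poly_additive T additive_scale vs scale)
  then have "free_ext T (free_scale s q x) = free_scale t q (free_ext T x)" for q x
    unfolding free_ext_def
    by (induction q)
      (simp_all add: free_scale_0 free_scale_pCons vs map_poly_add map_poly_pCons_additive T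
         additive.zero[OF T])
  then show ?thesis
    by (intro module_hom.intro module_free_scale vs module_hom_axioms.intro)
      (simp_all add: free_ext_def map_poly_add T)
qed

theorem proposition3p30:
  fixes sA :: "'k::field_char_0 \<Rightarrow> 'a::ab_group_add \<Rightarrow> 'a"
    and circ lie :: "'a \<Rightarrow> 'a \<Rightarrow> 'a"
    and sV :: "'k \<Rightarrow> 'v::ab_group_add \<Rightarrow> 'v"
    and l r \<rho> :: "'a \<Rightarrow> 'v \<Rightarrow> 'v"
    and T :: "'v \<Rightarrow> 'a"
  assumes "gd_algebra sA circ lie"
    and "gd_representation sA circ lie sV l r \<rho>"
    and "Vector_Spaces.linear sV sA T"
  shows "gd_O_operator sA circ lie sV l r \<rho> T \<longleftrightarrow>
    conformal_O_operator (free_scale sA) (gd_bracket sA circ lie)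
      (free_scale sV) (gd_rho sV l r \<rho>) (free_ext T)"
proof -
  interpret gd_representation sA circ lie sV l r \<rho> by fact
  have T: "additive T"
    using assms(3) by (simp add: additive_def module_hom_iff_linear[symmetric] module_hom_iff)
  note on_constants = conformal_O_operator_on_constants[OF T]
  show ?thesis
  proof
    assume "gd_O_operator sA circ lie sV l r \<rho> T"
    then interpret gd_O_operator sA circ lie sV l r \<rho> T .
    show "conformal_O_operator (free_scale sA) (gd_bracket sA circ lie)
        (free_scale sV) (gd_rho sV l r \<rho>) (free_ext T)"
    proof (intro conformal_O_operator.intro conformal_O_operator_axioms.intro)
      show "gd_bracket sA circ lie (free_ext T u) (free_ext T v) =
          map_poly (free_ext T) (gd_rho sV l r \<rho> (free_ext T u) v -
            at_neg_lam_der (free_scale sV) (gd_rho sV l r \<rho> (free_ext T v) u))" for u v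
      proof (rule conformal_O_operator_from_constants[OF T], unfold on_constants, intro conjI)
        fix u v
        show "lie (T u) (T v) = T (\<rho> (T u) v - \<rho> (T v) u)"
          by (rule T_lie)
        show circ_vu: "circ (T v) (T u) = T (l (T v) u + r (T u) v)"
          by (rule T_circ)
        show "circ (T u) (T v) + circ (T v) (T u) =
            T (l (T u) v + r (T v) u) + T (l (T v) u + r (T u) v)"
          by (simp only: circ_vu T_circ[of u v])
      qed
    qed (fact conformal_representation module_hom_free_ext[OF assms(3)])+
  next
    assume "conformal_O_operator (free_scale sA) (gd_bracket sA circ lie)
        (free_scale sV) (gd_rho sV l r \<rho>) (free_ext T)"
    then interpret C: conformal_O_operator "free_scale sA" "gd_bracket sA circ lie"
      "free_scale sV" "gd_rho sV l r \<rho>" "free_ext T" .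
    show "gd_O_operator sA circ lie sV l r \<rho> T"
    proof (intro gd_O_operator.intro assms gd_O_operator_axioms.intro)
      fix u v
      show "lie (T u) (T v) = T (\<rho> (T u) v - \<rho> (T v) u)"
        using C.T_br[of "[:u:]" "[:v:]"] unfolding on_constants by blast
      show "circ (T u) (T v) = T (l (T u) v + r (T v) u)"
        using C.T_br[of "[:v:]" "[:u:]"] unfolding on_constants by blast
    qed
  qed
qed

end
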